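(* Let $R$ be a commutative ring with unity, let $\{a_{n}\}_{n\geq 0}$ be a sequence of elements of $R$, let $S=\sum_{i\geq 0}a_{i}X^{i}\in R[[X]]$, and for each nonnegative integer $k$ write $S^{k}=\sum_{i\geq 0}\mathbf{a}_{i}^{(k)}X^{i}$. Then for all nonnegative integers $k$ and all $n\ge 0$, $$\mathbf{a}_{n+1}^{(k)}=a_{n+1}a_{0}^{k-1}\binom{k}{1}+\sum_{i=1}^{n}a_{i}\sum_{l=1}^{k-1}a_{0}^{l-1}\,\mathbf{a}_{n+1-i}^{(k-l)}.$$
   Context: Conventions: empty sums are $0$; $a_0^0=1$; for $k=0$ the term $a_0^{k-1}\binom{k}{1}$ is $0$ (even if $a_0$ is not invertible). *)

theory Defs
  imports "HOL-Computational_Algebra.Formal_Power_Series"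
begin

definition fps_power_coeff :: "(nat \<Rightarrow> 'a::comm_ring_1) \<Rightarrow> nat \<Rightarrow> nat \<Rightarrow> 'a" where
  "fps_power_coeff a k i = fps_nth (Abs_fps a ^ k) i"

end

theory Submission
  imports Defs
begin

text \<open>
  Multiplying \<open>S ^ k\<close> by \<open>S = a 0 + (S - a 0)\<close> and comparing coefficients at \<open>n + 1\<close> gives a
  first-order linear recursion in the exponent \<open>k\<close>, with multiplier \<open>a 0\<close>, and the theorem is
  the solution of that recursion. The inhomogeneous term contains \<open>S ^ k\<close> only
  at indices \<open>0, \<dots>, n\<close>. Index \<open>0\<close> contributes \<open>a (n + 1) * a 0 ^ k\<close>, which has the same value
  once it has been propagated to the last exponent, whatever the \<open>k\<close> it came from; these equal
  terms add up to the one with the binomial coefficient. The remaining indices produce the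
  geometric weights \<open>a 0 ^ (l - 1)\<close>. No division occurs, so the
  argument works over every commutative ring.
\<close>

lemma fps_power_coeff_0: "fps_power_coeff a k 0 = a 0 ^ k"
  by (simp add: fps_power_coeff_def fps_nth_power_0)

text \<open>
  In the Cauchy product for \<open>S * S ^ k\<close> the two extreme terms are split off: the first is the only
  one that reaches index \<open>n + 1\<close> of \<open>S ^ k\<close>, the last one meets its constant coefficient.
\<close>

lemma fps_power_coeff_Suc_exponent:
  "fps_power_coeff a (Suc k) (n + 1) =
     a 0 * fps_power_coeff a k (n + 1) + a (n + 1) * a 0 ^ k +
     (\<Sum>i = 1..n. a i * fps_power_coeff a k (n + 1 - i))"
proof -
  have "fps_power_coeff a (Suc k) (n + 1) =
      (\<Sum>i = 0..Suc n. a i * fps_power_coeff a k (Suc n - i))"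
    by (simp add: fps_power_coeff_def fps_mult_nth)
  also have "\<dots> = a 0 * fps_power_coeff a k (Suc n) +
      (\<Sum>i = 1..n. a i * fps_power_coeff a k (Suc n - i)) +
      a (Suc n) * fps_power_coeff a k 0"
    by (simp add: sum.atLeast_Suc_atMost)
  finally show ?thesis
    by (simp add: fps_power_coeff_0 algebra_simps)
qed

text \<open>
  One step of the recursion: multiplying the geometrically weighted sum by its ratio shifts the
  weights by one and makes room for a new leading term.
\<close>

lemma weighted_sum_Suc:
  fixes x :: "'a::comm_ring_1"
  assumes "k \<noteq> 0"
  shows "(\<Sum>l = 1..k. x ^ (l - 1) * f (Suc k - l)) =
    f k + x * (\<Sum>l = 1..k - 1. x ^ (l - 1) * f (k - l))"
proof -
  obtain m where k: "k = Suc m"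
    using assms not0_implies_Suc by blast
  have "(\<Sum>l = 1..Suc m. x ^ (l - 1) * f (Suc (Suc m) - l)) =
      f (Suc m) + (\<Sum>l = Suc 1..Suc m. x ^ (l - 1) * f (Suc (Suc m) - l))"
    by (simp add: sum.atLeast_Suc_atMost)
  also have "(\<Sum>l = Suc 1..Suc m. x ^ (l - 1) * f (Suc (Suc m) - l)) =
      (\<Sum>l = 1..m. x ^ l * f (Suc m - l))"
    by (subst sum.shift_bounds_cl_Suc_ivl) simp
  also have "\<dots> = x * (\<Sum>l = 1..m. x ^ (l - 1) * f (Suc m - l))"
    unfolding sum_distrib_left
    by (intro sum.cong refl) (auto simp: power_eq_if)
  finally show ?thesis
    using k by simp
qed

theorem theorem1p8:
  fixes a :: "nat \<Rightarrow> 'a::comm_ring_1" and k n :: nat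
  shows "fps_power_coeff a k (n + 1) =
    a (n + 1) * a 0 ^ (k - 1) * of_nat (k choose 1) +
    (\<Sum>i = 1..n. a i * (\<Sum>l = 1..k - 1. a 0 ^ (l - 1) * fps_power_coeff a (k - l) (n + 1 - i)))"
proof (induction k)
  case 0
  show ?case
    by (simp add: fps_power_coeff_def)
next
  case (Suc k)
  define T where "T k i = (\<Sum>l = 1..k - 1. a 0 ^ (l - 1) * fps_power_coeff a (k - l) (n + 1 - i))"
    for k i
  show ?case
  proof (cases "k = 0")
    (* The weighted sums are empty for exponents 0 and 1, so the step from 0 to 1 does not follow
       the shift pattern; S ^ 0 vanishes at all the indices n + 1 - i that occur. *)
    case True
    have "(\<Sum>i = 1..n. a i * fps_power_coeff a 0 (n + 1 - i)) = 0"
      by (intro sum.neutral) (auto simp: fps_power_coeff_def)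
    then show ?thesis
      using True fps_power_coeff_Suc_exponent[of a 0 n]
      by (simp add: fps_power_coeff_def)
  next
    case False
    then have power: "a 0 * a 0 ^ (k - 1) = a 0 ^ k"
      by (simp add: power_eq_if)
    have T_Suc: "T (Suc k) i = fps_power_coeff a k (n + 1 - i) + a 0 * T k i" for i
      using weighted_sum_Suc[OF False, of "a 0" "\<lambda>m. fps_power_coeff a m (n + 1 - i)"]
      by (simp add: T_def)
    have IH: "fps_power_coeff a k (n + 1) =
        a (n + 1) * a 0 ^ (k - 1) * of_nat k + (\<Sum>i = 1..n. a i * T k i)"
      using Suc.IH by (simp add: T_def)
    have "fps_power_coeff a (Suc k) (n + 1) =
        a (n + 1) * (a 0 * a 0 ^ (k - 1)) * of_nat k + a (n + 1) * a 0 ^ k +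
        (\<Sum>i = 1..n. a i * T (Suc k) i)"
      unfolding fps_power_coeff_Suc_exponent IH T_Suc
      by (simp add: algebra_simps sum.distrib sum_distrib_left)
    also have "\<dots> = a (n + 1) * a 0 ^ k * of_nat (Suc k) + (\<Sum>i = 1..n. a i * T (Suc k) i)"
      unfolding power by (simp add: algebra_simps)
    finally show ?thesis
      by (simp add: T_def)
  qed
qed

end
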